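(* Let $n,k$ be integers with $n\geq 5$ and $1\leq k\leq n$, and let $f_v(n,k)$ be the minimum integer such that every (connected) graph $G$ of order $n$ with $|E(G)|\geq f_v(n,k)$ satisfies $mvd(G)\geq k$. Then $f_v(n,k)=n-1$ if $k=1$; $f_v(n,k)=\frac{n(n-1)}{2}-1$ if $2\leq k\leq 3$; and $f_v(n,k)=\frac{n(n-1)}{2}$ if $4\leq k\leq n$.
   Context: All graphs are finite, simple, undirected and connected. For a vertex-colored graph and two nonadjacent vertices $x,y$, an $x$-$y$ vertex cut is a set $S\subseteq V(G)\setminus\{x,y\}$ such that $x$ and $y$ lie in different components of $G-S$; it is monochromatic if all its vertices have the same color. A vertex-coloring is an MVD-coloring if every pair of nonadjacent vertices has a monochromatic vertex cut separating them. $mvd(G)$ is the maximum number of colors used by an MVD-coloring of $G$.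
   Formalization: The minimum defining f_v(n,k) is taken only over integers that occur as the number of edges of some connected graph of order n; for k=1 every integer satisfies the stated condition, so the unrestricted minimum does not exist. For k≥2 this changes nothing. *)

theory Defs
  imports Main
begin

definition simple_graph :: "'a set \<Rightarrow> 'a set set \<Rightarrow> bool" where
  "simple_graph V E \<longleftrightarrow> finite V \<and> (\<forall>e\<in>E. e \<subseteq> V \<and> card e = 2)"

definition component_of :: "'a set \<Rightarrow> 'a set set \<Rightarrow> 'a \<Rightarrow> 'a set" where
  "component_of V E x = {y \<in> V. (x, y) \<in> {(u, v). {u, v} \<in> E}\<^sup>*}"

definition connected_graph :: "'a set \<Rightarrow> 'a set set \<Rightarrow> bool" where
  "connected_graph V E \<longleftrightarrow>
     simple_graph V E \<and> V \<noteq> {} \<and> (\<forall>x\<in>V. component_of V E x = V)"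

definition vertex_cut :: "'a set \<Rightarrow> 'a set set \<Rightarrow> 'a \<Rightarrow> 'a \<Rightarrow> 'a set \<Rightarrow> bool" where
  "vertex_cut V E x y S \<longleftrightarrow>
     S \<subseteq> V - {x, y} \<and>
     component_of (V - S) {e \<in> E. e \<inter> S = {}} x \<noteq>
     component_of (V - S) {e \<in> E. e \<inter> S = {}} y"

definition monochromatic :: "('a \<Rightarrow> 'c) \<Rightarrow> 'a set \<Rightarrow> bool" where
  "monochromatic c S \<longleftrightarrow> (\<forall>u\<in>S. \<forall>v\<in>S. c u = c v)"

definition mvd_coloring :: "'a set \<Rightarrow> 'a set set \<Rightarrow> ('a \<Rightarrow> 'c) \<Rightarrow> bool" where
  "mvd_coloring V E c \<longleftrightarrow>
     (\<forall>x\<in>V. \<forall>y\<in>V. x \<noteq> y \<and> {x, y} \<notin> E \<longrightarrow>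
        (\<exists>S. vertex_cut V E x y S \<and> monochromatic c S))"

definition mvd :: "'a set \<Rightarrow> 'a set set \<Rightarrow> nat" where
  "mvd V E = Max {card (c ` V) | c :: 'a \<Rightarrow> nat. mvd_coloring V E c}"

text \<open>
  Every finite graph is isomorphic to one with vertices in \<^typ>\<open>nat\<close>, so quantifying over those
  covers all graphs of order \<open>n\<close>. The minimum is taken over the edge numbers \<open>m\<close> that occur
  for connected graphs of order \<open>n\<close>: below the smallest such number the threshold
  condition says nothing new, and for \<open>k = 1\<close>, where every connected graph qualifies, an
  unrestricted minimum over the integers would not even exist.
\<close>

definition f_v :: "nat \<Rightarrow> nat \<Rightarrow> nat" where
  "f_v n k = (LEAST m.
     (\<exists>(V :: nat set) E. connected_graph V E \<and> card V = n \<and> card E = m) \<and>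
     (\<forall>(V :: nat set) E. connected_graph V E \<and> card V = n \<and> card E \<ge> m \<longrightarrow> mvd V E \<ge> k))"

end

theory Submission
  imports Defs Complex_Main
begin

text \<open>
  A common neighbour of two nonadjacent vertices \<open>x\<close>, \<open>y\<close> lies in every \<open>x\<close>-\<open>y\<close> cut. In a complete
  graph with the single edge \<open>ab\<close> removed, the only cut is therefore \<open>V - {a, b}\<close>, so exactly three
  colors can be used. If two disjoint edges \<open>ab\<close> and \<open>pq\<close> are removed, both \<open>V - {a, b}\<close> and
  \<open>V - {p, q}\<close> must be monochromatic; they overlap as soon as \<open>n \<ge> 5\<close>, which leaves one color.
  For \<open>k = 1\<close> every connected graph qualifies, and the threshold is the number of edges of a tree.
\<close>

subsection \<open>Connected graphs\<close>

text \<open>Any two vertices are linked through \<open>w\<close>. This one criterion covers the star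
  as well as the complete graphs with edges removed.\<close>

lemma connected_graph_universal_vertex:
  assumes "simple_graph V E" "w \<in> V" "\<And>v. v \<in> V \<Longrightarrow> v \<noteq> w \<Longrightarrow> {w, v} \<in> E"
  shows "connected_graph V E"
proof -
  let ?R = "{(u, v). {u, v} \<in> E}"
  have "(x, w) \<in> ?R\<^sup>*" "(w, x) \<in> ?R\<^sup>*" if "x \<in> V" for x
    using assms(3)[OF that] by (cases "x = w"; auto simp: insert_commute)+
  then have "component_of V E x = V" if "x \<in> V" for x
    using that unfolding component_of_def by (auto intro: rtrancl_trans)
  with assms(1,2) show ?thesis
    unfolding connected_graph_def by auto
qed

lemma finite_edges: "simple_graph V E \<Longrightarrow> finite E"
  unfolding simple_graph_def by (rule finite_subset[of E "Pow V"]) auto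

text \<open>Mapping each vertex other than a fixed root to the edge towards its parent in a
  breadth-first tree is injective.\<close>

lemma connected_graph_card_edges:
  assumes "connected_graph V E"
  shows "card V \<le> card E + 1"
proof -
  let ?R = "{(u, v). {u, v} \<in> E}"
  have sg: "simple_graph V E" and "V \<noteq> {}" and comp: "\<And>x. x \<in> V \<Longrightarrow> component_of V E x = V"
    using assms unfolding connected_graph_def by auto
  from \<open>V \<noteq> {}\<close> obtain r where r: "r \<in> V" by auto
  \<comment> \<open>\<open>d\<close> is the distance from the root, so the last vertex before
    \<open>y\<close> on a shortest walk can serve as the parent of \<open>y\<close>.\<close>
  define d where "d y = (LEAST i. (r, y) \<in> ?R ^^ i)" for y
  have "\<exists>p. {p, y} \<in> E \<and> d p < d y" if y: "y \<in> V - {r}" for y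
  proof -
    have "(r, y) \<in> ?R\<^sup>*"
      using comp[OF r] y unfolding component_of_def by blast
    then obtain i where "(r, y) \<in> ?R ^^ i"
      using rtrancl_imp_relpow by blast
    then have dy: "(r, y) \<in> ?R ^^ d y"
      unfolding d_def by (rule LeastI)
    have "d y \<noteq> 0"
      using dy y by (metis DiffE insertI1 relpow_0_E)
    then obtain j where j: "d y = Suc j"
      using not0_implies_Suc by blast
    with dy obtain p where p: "(r, p) \<in> ?R ^^ j" "(p, y) \<in> ?R"
      by (metis relpow_Suc_E)
    have "d p \<le> j"
      unfolding d_def using p(1) by (rule Least_le)
    with p(2) j show ?thesis by auto
  qed
  then obtain p where p: "\<And>y. y \<in> V - {r} \<Longrightarrow> {p y, y} \<in> E \<and> d (p y) < d y"
    by metis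
  have inj: "inj_on (\<lambda>y. {p y, y}) (V - {r})"
  proof (rule inj_onI)
    fix y z assume "y \<in> V - {r}" "z \<in> V - {r}" "{p y, y} = {p z, z}"
    \<comment> \<open>If \<open>y\<close> and \<open>z\<close> differed, equality of the edges would
      force \<open>p y = z\<close> and \<open>p z = y\<close>, and \<open>d\<close> would decrease
      in both directions.\<close>
    with p[of y] p[of z] show "y = z"
      by (auto simp: doubleton_eq_iff)
  qed
  have "card (V - {r}) \<le> card E"
    by (rule card_inj_on_le[OF inj _ finite_edges[OF sg]]) (use p in blast)
  with r show ?thesis
    using sg by (simp add: simple_graph_def card_Diff_singleton)
qed

subsection \<open>Vertex cuts and the monochromatic disconnection number\<close>

text \<open>Deleting all other vertices leaves no edge, so \<open>x\<close> and \<open>y\<close>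
  become singleton components. Hence every nonadjacent pair has some cut, which is what makes
  constant colorings valid.\<close>

lemma vertex_cut_all_others:
  assumes "simple_graph V E" "x \<in> V" "y \<in> V" "x \<noteq> y" "{x, y} \<notin> E"
  shows "vertex_cut V E x y (V - {x, y})"
proof -
  let ?E = "{e \<in> E. e \<inter> (V - {x, y}) = {}}"
  have "?E = {}"
  proof -
    have "e = {x, y}" if "e \<in> ?E" for e
    proof -
      have "e \<subseteq> {x, y}" "card e = 2"
        using that assms(1) unfolding simple_graph_def by auto
      with assms(4) show ?thesis
        by (intro card_subset_eq) auto
    qed
    with assms(5) show ?thesis by blast
  qed
  moreover have "component_of (V - (V - {x, y})) {} z = {z}" if "z \<in> {x, y}" for z
    using that assms(2,3) unfolding component_of_def by auto
  ultimately have "component_of (V - (V - {x, y})) ?E z = {z}" if "z \<in> {x, y}" for z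
    using that by metis
  with assms(4) show ?thesis
    unfolding vertex_cut_def by auto
qed

text \<open>If \<open>z\<close> survived the deletion of \<open>S\<close>, so would the walk from
  \<open>x\<close> through \<open>z\<close> to \<open>y\<close>, and the two components would
  coincide.\<close>

lemma common_neighbour_in_vertex_cut:
  assumes "vertex_cut V E x y S" "{x, z} \<in> E" "{z, y} \<in> E"
  shows "z \<in> S"
proof (rule ccontr)
  assume z: "z \<notin> S"
  let ?E = "{e \<in> E. e \<inter> S = {}}"
  let ?R = "{(u, v). {u, v} \<in> ?E}"
  have "x \<notin> S" "y \<notin> S"
    using assms(1) unfolding vertex_cut_def by auto
  with z assms(2,3) have "(x, z) \<in> ?R" "(z, y) \<in> ?R" "(z, x) \<in> ?R" "(y, z) \<in> ?R"
    by (auto simp: insert_commute)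
  then have "(x, y) \<in> ?R\<^sup>*" "(y, x) \<in> ?R\<^sup>*"
    by (meson r_into_rtrancl rtrancl_trans)+
  then have "component_of (V - S) ?E x = component_of (V - S) ?E y"
    unfolding component_of_def by (auto intro: rtrancl_trans)
  with assms(1) show False
    unfolding vertex_cut_def by blast
qed

lemma mvd_coloring_const: "simple_graph V E \<Longrightarrow> mvd_coloring V E (\<lambda>_. c)"
  unfolding mvd_coloring_def monochromatic_def by (meson vertex_cut_all_others)

text \<open>There may be infinitely many colorings into \<open>nat\<close>, but their color counts
  are bounded by \<open>card V\<close>; this makes the \<open>Max\<close> in \<open>mvd\<close>
  meaningful.\<close>

lemma finite_mvd_set:
  assumes "finite V"
  shows "finite {card (c ` V) | c :: 'a \<Rightarrow> nat. mvd_coloring V E c}"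
  by (rule finite_subset[of _ "{..card V}"]) (use assms in \<open>auto intro: card_image_le\<close>)

lemma mvd_ge:
  fixes c :: "'a \<Rightarrow> nat"
  assumes "finite V" "mvd_coloring V E c"
  shows "card (c ` V) \<le> mvd V E"
  unfolding mvd_def by (rule Max_ge[OF finite_mvd_set[OF assms(1)]]) (use assms(2) in blast)

lemma mvd_le:
  assumes "simple_graph V E"
    and "\<And>c :: 'a \<Rightarrow> nat. mvd_coloring V E c \<Longrightarrow> card (c ` V) \<le> m"
  shows "mvd V E \<le> m"
proof -
  let ?A = "{card (c ` V) | c :: 'a \<Rightarrow> nat. mvd_coloring V E c}"
  \<comment> \<open>A bound on all members bounds \<open>Max\<close> only for a nonempty set; a
    constant coloring supplies a member.\<close>
  have "?A \<noteq> {}"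
    using mvd_coloring_const[OF assms(1), of "0 :: nat"] by auto
  moreover have "finite ?A"
    using assms(1) unfolding simple_graph_def by (intro finite_mvd_set) blast
  moreover have "i \<le> m" if "i \<in> ?A" for i
    using that assms(2) by blast
  ultimately show ?thesis
    unfolding mvd_def by (intro Max.boundedI)
qed

lemma mvd_connected_ge_1:
  assumes "connected_graph V E"
  shows "1 \<le> mvd V E"
proof -
  have sg: "simple_graph V E" and "V \<noteq> {}"
    using assms unfolding connected_graph_def by auto
  then show ?thesis
    using mvd_ge[OF _ mvd_coloring_const[OF sg, of 0]] by (simp add: simple_graph_def image_constant_conv)
qed

subsection \<open>Complete graphs with few edges removed\<close>

definition complete_edges :: "'a set \<Rightarrow> 'a set set" where
  "complete_edges V = {e. e \<subseteq> V \<and> card e = 2}"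

lemma doubleton_in_complete_edges [simp]:
  "{x, y} \<in> complete_edges V \<longleftrightarrow> x \<in> V \<and> y \<in> V \<and> x \<noteq> y"
  unfolding complete_edges_def by (auto simp: card_insert_if)

lemma finite_complete_edges: "finite V \<Longrightarrow> finite (complete_edges V)"
  unfolding complete_edges_def by (rule finite_subset[of _ "Pow V"]) auto

lemma card_complete_edges: "finite V \<Longrightarrow> card (complete_edges V) = card V * (card V - 1) div 2"
  unfolding complete_edges_def by (simp add: n_subsets choose_two)

lemma simple_graph_iff: "simple_graph V E \<longleftrightarrow> finite V \<and> E \<subseteq> complete_edges V"
  unfolding simple_graph_def complete_edges_def by auto

lemma connected_complete_minus:
  assumes "finite V" "w \<in> V" "w \<notin> \<Union>F"
  shows "connected_graph V (complete_edges V - F)"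
  by (rule connected_graph_universal_vertex[of _ _ w])
    (use assms in \<open>auto simp: simple_graph_iff\<close>)

text \<open>Without nonadjacent pairs the coloring condition is vacuous, so all vertices may receive
  different colors.\<close>

lemma mvd_complete:
  assumes "finite V"
  shows "mvd V (complete_edges V) \<ge> card V"
proof -
  obtain c :: "'a \<Rightarrow> nat" where "inj_on c V"
    using finite_imp_inj_to_nat_seg[OF assms] by blast
  moreover have "mvd_coloring V (complete_edges V) c"
    unfolding mvd_coloring_def by auto
  ultimately show ?thesis
    using mvd_ge[OF assms] by (metis card_image)
qed

lemma mvd_complete_minus_edge_ge:
  assumes "finite V" "card V \<ge> 3" "e \<in> complete_edges V"
  shows "mvd V (complete_edges V - {e}) \<ge> 3"
proof -
  let ?E = "complete_edges V - {e}"
  obtain a b where e: "e = {a, b}" "a \<noteq> b" "a \<in> V" "b \<in> V"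
    using assms(3) unfolding complete_edges_def by (auto simp: card_2_iff)
  \<comment> \<open>The ends of the missing edge get private colors; the rest, which is the cut to
    be used, gets color 0.\<close>
  define c :: "'a \<Rightarrow> nat" where "c v = (if v = a then 1 else if v = b then 2 else 0)" for v
  have "\<exists>S. vertex_cut V ?E x y S \<and> monochromatic c S"
    if "x \<in> V" "y \<in> V" "x \<noteq> y" "{x, y} \<notin> ?E" for x y
  proof -
    have "{x, y} = {a, b}"
      using that e by auto
    then have "monochromatic c (V - {x, y})"
      unfolding monochromatic_def c_def by auto
    moreover have "vertex_cut V ?E x y (V - {x, y})"
      using that assms(1) by (intro vertex_cut_all_others) (auto simp: simple_graph_iff)
    ultimately show ?thesis by blast
  qed
  then have mvdc: "mvd_coloring V ?E c"
    unfolding mvd_coloring_def by blast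
  \<comment> \<open>A third vertex is required for color 0 to occur at all.\<close>
  have "\<not> V \<subseteq> {a, b}"
    using assms(2) e(2) card_mono[of "{a, b}" V] by auto
  then obtain w where "w \<in> V" "w \<noteq> a" "w \<noteq> b" by blast
  with e have "{0, 1, 2} \<subseteq> c ` V"
    unfolding c_def by (auto simp: image_iff)
  then have "card {0, 1, 2 :: nat} \<le> card (c ` V)"
    using assms(1) by (intro card_mono) auto
  then show ?thesis
    using mvd_ge[OF assms(1) mvdc] by simp
qed

text \<open>Every other vertex is a common neighbour of \<open>a\<close> and \<open>b\<close>, so
  any monochromatic cut contains all of them. Both upper bounds below rest on this.\<close>

lemma mvd_coloring_common_neighbours:
  assumes "mvd_coloring V E c" "a \<in> V" "b \<in> V" "a \<noteq> b" "{a, b} \<notin> E"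
    and "\<And>v. v \<in> V - {a, b} \<Longrightarrow> {a, v} \<in> E \<and> {v, b} \<in> E"
  shows "monochromatic c (V - {a, b})"
proof -
  obtain S where S: "vertex_cut V E a b S" "monochromatic c S"
    using assms(1-5) unfolding mvd_coloring_def by blast
  have "V - {a, b} \<subseteq> S"
    using common_neighbour_in_vertex_cut[OF S(1)] assms(6) by blast
  with S(2) show ?thesis
    unfolding monochromatic_def by blast
qed

lemma mvd_complete_minus_edge_le:
  assumes "finite V" "a \<in> V" "b \<in> V" "a \<noteq> b"
  shows "mvd V (complete_edges V - {{a, b}}) \<le> 3"
proof (rule mvd_le)
  show "simple_graph V (complete_edges V - {{a, b}})"
    using assms(1) by (auto simp: simple_graph_iff)
next
  fix c :: "'a \<Rightarrow> nat"
  assume "mvd_coloring V (complete_edges V - {{a, b}}) c"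
  then have mono: "monochromatic c (V - {a, b})"
    by (rule mvd_coloring_common_neighbours) (use assms in \<open>auto simp: doubleton_eq_iff\<close>)
  \<comment> \<open>\<open>t\<close> is the shared color of \<open>V - {a, b}\<close>; if that set
    is empty, any value will do.\<close>
  have "\<exists>t. c ` V \<subseteq> {c a, c b, t}"
  proof (cases "V \<subseteq> {a, b}")
    case False
    then obtain w where "w \<in> V - {a, b}" by blast
    with mono have "c ` V \<subseteq> {c a, c b, c w}"
      unfolding monochromatic_def by blast
    then show ?thesis ..
  qed blast
  then obtain t where t: "c ` V \<subseteq> {c a, c b, t}" ..
  have "card (c ` V) \<le> card {c a, c b, t}"
    using t by (intro card_mono) auto
  also have "\<dots> \<le> 3"
    by (simp add: card_insert_if)
  finally show "card (c ` V) \<le> 3" .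
qed

lemma mvd_complete_minus_two_edges_le:
  assumes "finite V" "w \<in> V" "{a, b, p, q} \<subseteq> V" "distinct [a, b, p, q, w]"
  shows "mvd V (complete_edges V - {{a, b}, {p, q}}) \<le> 1"
proof (rule mvd_le)
  show "simple_graph V (complete_edges V - {{a, b}, {p, q}})"
    using assms(1) by (auto simp: simple_graph_iff)
next
  fix c :: "'a \<Rightarrow> nat"
  assume c: "mvd_coloring V (complete_edges V - {{a, b}, {p, q}}) c"
  have 1: "monochromatic c (V - {a, b})"
    by (rule mvd_coloring_common_neighbours[OF c]) (use assms in \<open>auto simp: doubleton_eq_iff\<close>)
  have 2: "monochromatic c (V - {p, q})"
    by (rule mvd_coloring_common_neighbours[OF c]) (use assms in \<open>auto simp: doubleton_eq_iff\<close>)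
  \<comment> \<open>\<open>w\<close> lies in both monochromatic sets, and since the pairs are
    disjoint each \<open>v\<close> lies in at least one of them.\<close>
  have "c v = c w" if "v \<in> V" for v
  proof (cases "v \<in> {a, b}")
    case True
    then have "v \<in> V - {p, q}" "w \<in> V - {p, q}"
      using that assms by auto
    with 2 show ?thesis unfolding monochromatic_def by blast
  next
    case False
    then have "v \<in> V - {a, b}" "w \<in> V - {a, b}"
      using that assms by auto
    with 1 show ?thesis unfolding monochromatic_def by blast
  qed
  then have "c ` V \<subseteq> {c w}" by blast
  then have "card (c ` V) \<le> card {c w}" by (intro card_mono) auto
  then show "card (c ` V) \<le> 1" by simp
qed

lemma complete_or_minus_edge:
  assumes "simple_graph V E" "card E \<ge> card V * (card V - 1) div 2 - 1"
  shows "E = complete_edges V \<or> (\<exists>e\<in>complete_edges V. E = complete_edges V - {e})"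
proof -
  let ?K = "complete_edges V"
  have fin: "finite V" and sub: "E \<subseteq> ?K"
    using assms(1) by (auto simp: simple_graph_iff)
  have "card (?K - E) = card ?K - card E"
    using finite_edges[OF assms(1)] sub by (rule card_Diff_subset)
  with assms(2) fin have "card (?K - E) \<le> 1"
    by (simp add: card_complete_edges)
  then consider "card (?K - E) = 0" | "card (?K - E) = 1"
    by linarith
  then show ?thesis
  proof cases
    case 1
    with finite_complete_edges[OF fin] have "?K - E = {}" by simp
    with sub show ?thesis by blast
  next
    case 2
    then obtain e where "?K - E = {e}"
      by (rule card_1_singletonE)
    with sub have "e \<in> ?K" "E = ?K - {e}" by auto
    then show ?thesis by blast
  qed
qed

subsection \<open>The threshold\<close>

text \<open>A single bad graph with one edge fewer than \<open>m\<close> refutes every smaller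
  threshold, because it meets the edge bound of each of them. Writing \<open>card E' + 1 = m\<close>
  avoids truncated subtraction.\<close>

lemma f_v_eqI:
  assumes "connected_graph (V :: nat set) E" "card V = n" "card E = m"
    and "\<And>(V :: nat set) E. connected_graph V E \<Longrightarrow> card V = n \<Longrightarrow> card E \<ge> m \<Longrightarrow> mvd V E \<ge> k"
    and "connected_graph (V' :: nat set) E'" "card V' = n" "card E' + 1 = m" "mvd V' E' < k"
  shows "f_v n k = m"
  unfolding f_v_def
proof (rule Least_equality)
  fix j
  assume "(\<exists>(V :: nat set) E. connected_graph V E \<and> card V = n \<and> card E = j) \<and>
     (\<forall>(V :: nat set) E. connected_graph V E \<and> card V = n \<and> card E \<ge> j \<longrightarrow> mvd V E \<ge> k)"
  then have "card E' \<ge> j \<longrightarrow> mvd V' E' \<ge> k"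
    using assms(5,6) by blast
  with assms(7,8) show "m \<le> j" by simp
qed (use assms in blast)

text \<open>A star attains \<open>n - 1\<close>. Minimality comes from the requirement that the
  threshold be the edge number of a connected graph, not from a graph violating the bound on
  \<open>mvd\<close>.\<close>

lemma f_v_1:
  assumes "n \<ge> 1"
  shows "f_v n 1 = n - 1"
  unfolding f_v_def
proof (rule Least_equality)
  let ?E = "(\<lambda>v. {0, v}) ` {1..<n}"
  have "connected_graph {..<n} ?E"
    by (rule connected_graph_universal_vertex[of _ _ 0])
      (use assms in \<open>auto simp: simple_graph_def card_insert_if\<close>)
  moreover have "card ?E = n - 1"
    by (subst card_image) (auto simp: inj_on_def doubleton_eq_iff)
  ultimately show "(\<exists>(V :: nat set) E. connected_graph V E \<and> card V = n \<and> card E = n - 1) \<and>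
     (\<forall>(V :: nat set) E. connected_graph V E \<and> card V = n \<and> card E \<ge> n - 1 \<longrightarrow> mvd V E \<ge> 1)"
    using mvd_connected_ge_1 by (metis card_lessThan)
next
  fix j
  assume "(\<exists>(V :: nat set) E. connected_graph V E \<and> card V = n \<and> card E = j) \<and>
     (\<forall>(V :: nat set) E. connected_graph V E \<and> card V = n \<and> card E \<ge> j \<longrightarrow> mvd V E \<ge> 1)"
  then show "n - 1 \<le> j"
    using connected_graph_card_edges by fastforce
qed

theorem theorem1p4:
  fixes n k :: nat
  assumes "n \<ge> 5" and "1 \<le> k" and "k \<le> n"
  shows "(k = 1 \<longrightarrow> f_v n k = n - 1) \<and>
         (2 \<le> k \<and> k \<le> 3 \<longrightarrow> f_v n k = n * (n - 1) div 2 - 1) \<and>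
         (4 \<le> k \<and> k \<le> n \<longrightarrow> f_v n k = n * (n - 1) div 2)"
proof -
  let ?V = "{..<n}"
  let ?K = "complete_edges ?V"
  let ?N = "n * (n - 1) div 2"
  have K: "card ?K = ?N" "finite ?K"
    by (simp_all add: card_complete_edges finite_complete_edges)
  \<comment> \<open>A lower bound on the number of edges ensures that the subtractions of 1 and 2
    below are not truncated.\<close>
  have "5 * 4 \<le> n * (n - 1)"
    using assms(1) by (intro mult_le_mono) auto
  then have N: "?N \<ge> 10" by simp
  \<comment> \<open>Vertex 4 avoids the removed edges and so stays adjacent to all others; it exists
    because \<open>n\<close> is at least 5.\<close>
  have conn: "connected_graph ?V ?K" "connected_graph ?V (?K - {{0, 1}})"
    "connected_graph ?V (?K - {{0, 1}, {2, 3}})"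
    using connected_complete_minus[of ?V 4 "{}"] connected_complete_minus[of ?V 4 "{{0, 1}}"]
      connected_complete_minus[of ?V 4 "{{0, 1}, {2, 3}}"] assms(1) by auto
  have card1: "card (?K - {{0, 1}}) = ?N - 1"
    using K assms(1) by (subst card_Diff_subset) auto
  have card2: "card (?K - {{0, 1}, {2, 3}}) = ?N - 2"
    using K assms(1) by (subst card_Diff_subset) (auto simp: doubleton_eq_iff)
  have mvd1: "mvd ?V (?K - {{0, 1}}) \<le> 3"
    using assms(1) by (intro mvd_complete_minus_edge_le) auto
  have mvd2: "mvd ?V (?K - {{0, 1}, {2, 3}}) \<le> 1"
    using assms(1) by (intro mvd_complete_minus_two_edges_le[of _ 4]) auto
  have ge: "mvd V E \<ge> 3" if conn: "connected_graph V E" and n: "card V = n" and ge: "card E \<ge> ?N - 1"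
    for V :: "nat set" and E
  proof -
    have sg: "simple_graph V E" and fin: "finite V"
      using conn unfolding connected_graph_def simple_graph_def by auto
    consider "E = complete_edges V" | e where "e \<in> complete_edges V" "E = complete_edges V - {e}"
      using complete_or_minus_edge[OF sg] n ge by blast
    then show ?thesis
    proof cases
      case 1
      then show ?thesis using mvd_complete[OF fin] n assms(1) by simp
    next
      case 2
      then show ?thesis using mvd_complete_minus_edge_ge[OF fin] n assms(1) by simp
    qed
  qed
  have ge': "mvd V E \<ge> n" if "connected_graph V E" "card V = n" "card E \<ge> ?N"
    for V :: "nat set" and E
  proof -
    have fin: "finite V" and sub: "E \<subseteq> complete_edges V"
      using that(1) unfolding connected_graph_def by (auto simp: simple_graph_iff)
    have "E = complete_edges V"
      using that(2,3) finite_complete_edges[OF fin] sub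
      by (intro card_seteq) (auto simp: card_complete_edges[OF fin])
    then show ?thesis using mvd_complete[OF fin] that(2) by simp
  qed
  \<comment> \<open>Removing one edge attains the threshold; removing two disjoint edges gives the
    bad graph, as its \<open>mvd\<close> is at most 1.\<close>
  have "f_v n k = ?N - 1" if "2 \<le> k" "k \<le> 3"
  proof (rule f_v_eqI[OF conn(2) _ card1 _ conn(3)])
    show "mvd V E \<ge> k" if "connected_graph V E" "card V = n" "card E \<ge> ?N - 1"
      for V :: "nat set" and E
      using ge[OF that] \<open>k \<le> 3\<close> by simp
    show "card (?K - {{0, 1}, {2, 3}}) + 1 = ?N - 1"
      using card2 N by linarith
  qed (use that mvd2 in auto)
  \<comment> \<open>Now the graph with one edge removed is itself the bad graph, since its
    \<open>mvd\<close> is at most 3.\<close>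
  moreover have "f_v n k = ?N" if "4 \<le> k"
  proof (rule f_v_eqI[OF conn(1) _ K(1) _ conn(2)])
    show "mvd V E \<ge> k" if "connected_graph V E" "card V = n" "card E \<ge> ?N"
      for V :: "nat set" and E
      using ge'[OF that] assms(3) by simp
    show "card (?K - {{0, 1}}) + 1 = ?N"
      using card1 N by linarith
  qed (use that mvd1 in auto)
  ultimately show ?thesis
    using f_v_1[of n] assms(1) by auto
qed

end
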